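(* Let $(\Omega,\mathcal{A},P_0)$ be a probability space with $P_0$ $\sigma$-additive, and let $L$ be a convex cone of real random variables on it. There is an equivalent super-martingale measure (ESM) for $L$ if and only if there are a $\sigma$-additive probability $Q$ on $\mathcal{A}$ with $Q\sim P_0$ and a constant $k\geq 0$ such that $$E_Q|X|<\infty\quad\text{and}\quad E_Q(X)\leq k\,E_Q(X^-)\quad\text{for all }X\in L.$$ Moreover, there is an ESM $P$ for $L$ such that $r\,P_0\leq P\leq s\,P_0$ for some constants $0<r\leq s$ if and only if there is a constant $k\geq 0$ such that $$E_{P_0}|X|<\infty\quad\text{and}\quad E_{P_0}(X)\leq k\,E_{P_0}(X^-)\quad\text{for all }X\in L.$$
   Context: A real random variable is an $\mathcal{A}$-measurable function $\Omega\to\mathbb{R}$. A set $L$ of real random variables is a convex cone if $\sum_{j=1}^n\lambda_jX_j\in L$ for all $n\geq 1$, $\lambda_1,\ldots,\lambda_n\geq 0$ and $X_1,\ldots,X_n\in L$. $X^-=\max(-X,0)$. For probabilities $P,T$ on $\mathcal{A}$, $P\sim T$ means that $P$ and $T$ have the same null sets in $\mathcal{A}$. Inequalities such as $r\,P_0\leq P\leq s\,P_0$ mean $r\,P_0(A)\leq P(A)\leq s\,P_0(A)$ for all $A\in\mathcal{A}$. An equivalent super-martingale measure (ESM) for $L$ is a $\sigma$-additive probability $P$ on $\mathcal{A}$ such that $P\sim P_0$, $E_P|X|<\infty$ and $E_P(X)\leq 0$ for all $X\in L$. *)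

theory Defs
  imports "HOL-Probability.Probability"
begin

(* A random variable on the space of M is a total function 'a => real; only its values on
   space M matter. As n >= 1, the empty set is a convex cone. *)
definition convex_cone_of_rvs :: "'a measure \<Rightarrow> ('a \<Rightarrow> real) set \<Rightarrow> bool" where
  "convex_cone_of_rvs M L \<longleftrightarrow>
     L \<subseteq> borel_measurable M \<and>
     (\<forall>n\<ge>1. \<forall>(c :: nat \<Rightarrow> real) (X :: nat \<Rightarrow> 'a \<Rightarrow> real).
        (\<forall>j\<in>{1..n}. 0 \<le> c j \<and> X j \<in> L) \<longrightarrow> (\<lambda>\<omega>. \<Sum>j=1..n. c j * X j \<omega>) \<in> L)"

definition neg_part :: "('a \<Rightarrow> real) \<Rightarrow> 'a \<Rightarrow> real" where
  "neg_part X = (\<lambda>\<omega>. max (- X \<omega>) 0)"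

definition equivalent_prob :: "'a measure \<Rightarrow> 'a measure \<Rightarrow> bool" where
  "equivalent_prob M Q \<longleftrightarrow> prob_space Q \<and> sets Q = sets M \<and> null_sets Q = null_sets M"

definition ESM :: "'a measure \<Rightarrow> ('a \<Rightarrow> real) set \<Rightarrow> 'a measure \<Rightarrow> bool" where
  "ESM M L P \<longleftrightarrow>
     equivalent_prob M P \<and> (\<forall>X\<in>L. integrable P X \<and> (\<integral>\<omega>. X \<omega> \<partial>P) \<le> 0)"

end

theory Submission
  imports Defs "HOL-Library.Function_Algebras"
begin

text \<open>Write \<open>c = 1 + k\<close>. The hypothesis on \<open>X\<close> says that \<open>E\<^sub>Q(X\<^sup>+) \<le> c E\<^sub>Q(X\<^sup>-)\<close>, that is, some
unnormalised density with values in \<open>{1, c}\<close>, depending on \<open>X\<close>, makes the expectation of \<open>X\<close> nonpositive. The problem is to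
find one density that works for all \<open>X \<in> L\<close> at once.

A functional \<open>X \<mapsto> E\<^sub>Q(f X)\<close> with \<open>1 \<le> f \<le> c\<close> is dominated by
\<open>p X = E\<^sub>Q(max X (c X))\<close>, which is sublinear on the space of \<open>Q\<close>-integrable functions; and for
\<open>X \<in> L\<close> one has \<open>p (- X) = k E\<^sub>Q(X\<^sup>-) - E\<^sub>Q(X)\<close>, which the hypothesis makes nonnegative. So \<open>p\<close>
dominates the zero functional on the cone \<open>- L\<close>, and the Mazur--Orlicz form of the Hahn--Banach
theorem (\<open>mazur_orlicz\<close>) gives a linear \<open>\<phi> \<le> p\<close> with \<open>\<phi> \<ge> 0\<close> on \<open>- L\<close>, that is, \<open>\<phi> \<le> 0\<close> on \<open>L\<close>.
Evaluating \<open>p\<close> at \<open>1\<^sub>A\<close> and at \<open>- 1\<^sub>A\<close> gives \<open>Q(A) \<le> \<phi>(1\<^sub>A) \<le> c Q(A)\<close>. The upper bound turns the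
finitely additive set function \<open>A \<mapsto> \<phi>(1\<^sub>A)\<close> into a measure that has \<open>\<phi>\<close> as its integral
(\<open>bounded_positive_functional_is_integral\<close>); the lower bound makes it equivalent to \<open>Q\<close>. Dividing by
the total mass, which lies between \<open>1\<close> and \<open>c\<close>, yields the measure \<open>P\<close>, with
\<open>Q / c \<le> P \<le> c Q\<close> (\<open>supermartingale_measure_exists\<close>). Both implications towards an ESM follow, the
second one by taking \<open>Q = P\<^sub>0\<close>.

Conversely, an ESM \<open>P\<close> satisfies the first condition with \<open>Q = P\<close> and \<open>k = 0\<close>. If moreover
\<open>r P\<^sub>0 \<le> P \<le> s P\<^sub>0\<close>, then \<open>E\<^sub>P(X\<^sup>+) \<le> E\<^sub>P(X\<^sup>-)\<close> transfers to \<open>P\<^sub>0\<close> at the cost of the factor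
\<open>s / r\<close>, which gives the second condition with \<open>k = s / r - 1\<close>.\<close>

section \<open>Sublinear functionals and the Mazur--Orlicz theorem\<close>

lemma le_cINF_add_cINF:
  fixes f :: "'i \<Rightarrow> real" and g :: "'j \<Rightarrow> real"
  assumes "I \<noteq> {}" "J \<noteq> {}" and le: "\<And>i j. i \<in> I \<Longrightarrow> j \<in> J \<Longrightarrow> u \<le> f i + g j"
  shows "u \<le> (INF i\<in>I. f i) + (INF j\<in>J. g j)"
proof -
  have "u - f i \<le> (INF j\<in>J. g j)" if "i \<in> I" for i
    using le[OF that] by (intro cINF_greatest \<open>J \<noteq> {}\<close>) (simp add: algebra_simps)
  then have "u - (INF j\<in>J. g j) \<le> (INF i\<in>I. f i)"
    by (intro cINF_greatest \<open>I \<noteq> {}\<close>) (simp add: algebra_simps)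
  then show ?thesis
    by simp
qed

text \<open>The scalar multiplication is a parameter, so that pointwise operations on real functions fit in, and
a carrier \<open>V\<close> is kept because the integrable functions are only a subspace of all functions.\<close>

locale real_subspace = vector_space scale
  for scale :: "real \<Rightarrow> 'b::ab_group_add \<Rightarrow> 'b" (infixr "\<odot>" 75) +
  fixes V :: "'b set"
  assumes subspace_V: "subspace V"
begin

lemma V_zero: "0 \<in> V" and V_add: "x \<in> V \<Longrightarrow> y \<in> V \<Longrightarrow> x + y \<in> V"
  and V_scale: "x \<in> V \<Longrightarrow> c \<odot> x \<in> V" and V_neg: "x \<in> V \<Longrightarrow> - x \<in> V"
  using subspace_V by (auto intro: subspace_0 subspace_add subspace_scale subspace_neg)

text \<open>Homogeneity is required only as an inequality for positive factors, together with \<open>p 0 = 0\<close>;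
equality follows by applying the inequality to \<open>1 / c\<close> (\<open>sublinear_scale\<close>).\<close>

definition sublinear :: "('b \<Rightarrow> real) \<Rightarrow> bool" where
  "sublinear p \<longleftrightarrow> p 0 = 0 \<and> (\<forall>x\<in>V. \<forall>y\<in>V. p (x + y) \<le> p x + p y) \<and>
     (\<forall>x\<in>V. \<forall>c>0. p (c \<odot> x) \<le> c * p x)"

definition subcone :: "'b set \<Rightarrow> bool" where
  "subcone C \<longleftrightarrow> C \<subseteq> V \<and> 0 \<in> C \<and> (\<forall>x\<in>C. \<forall>y\<in>C. x + y \<in> C) \<and> (\<forall>x\<in>C. \<forall>c>0. c \<odot> x \<in> C)"

definition superlinear_on :: "'b set \<Rightarrow> ('b \<Rightarrow> real) \<Rightarrow> bool" where
  "superlinear_on C r \<longleftrightarrow> r 0 = 0 \<and> (\<forall>x\<in>C. \<forall>y\<in>C. r x + r y \<le> r (x + y)) \<and>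
     (\<forall>x\<in>C. \<forall>c>0. c * r x \<le> r (c \<odot> x))"

definition linear_functional :: "('b \<Rightarrow> real) \<Rightarrow> bool" where
  "linear_functional \<phi> \<longleftrightarrow> (\<forall>x\<in>V. \<forall>y\<in>V. \<phi> (x + y) = \<phi> x + \<phi> y) \<and>
     (\<forall>x\<in>V. \<forall>c. \<phi> (c \<odot> x) = c * \<phi> x)"

lemma sublinear_scale:
  assumes p: "sublinear p" and x: "x \<in> V" and c: "c \<ge> 0"
  shows "p (c \<odot> x) = c * p x"
proof (cases "c = 0")
  case True
  then show ?thesis using p by (simp add: sublinear_def)
next
  case False
  with c have c: "c > 0" by simp
  have "p ((1 / c) \<odot> (c \<odot> x)) \<le> (1 / c) * p (c \<odot> x)"
    using p V_scale[OF x, of c] zero_less_divide_1_iff[THEN iffD2, OF c] unfolding sublinear_def by blast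
  with c have "c * p x \<le> p (c \<odot> x)" by (simp add: pos_le_divide_eq mult.commute)
  moreover have "p (c \<odot> x) \<le> c * p x"
    using p c x by (simp add: sublinear_def)
  ultimately show ?thesis by simp
qed

lemma sublinear_neg_le:
  assumes p: "sublinear p" and x: "x \<in> V"
  shows "- p (- x) \<le> p x"
proof -
  have "p (x + - x) \<le> p x + p (- x)"
    using p x V_neg[OF x] unfolding sublinear_def by blast
  with p show ?thesis by (simp add: sublinear_def)
qed

text \<open>The one construction behind both \<open>minimal_sublinear_is_linear\<close> and \<open>mazur_orlicz\<close>. Under the
hypotheses of the next lemma it is the largest sublinear functional \<open>p'\<close> on \<open>V\<close> that lies below \<open>p\<close> and
satisfies \<open>p' (- y) \<le> - r y\<close> for all \<open>y \<in> C\<close>. Outside \<open>V\<close> the value is fixed to \<open>0\<close>, so that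
functionals that agree on \<open>V\<close> are equal, as antisymmetry in the application of Zorn's lemma demands.\<close>

definition tilt :: "'b set \<Rightarrow> ('b \<Rightarrow> real) \<Rightarrow> ('b \<Rightarrow> real) \<Rightarrow> 'b \<Rightarrow> real" where
  "tilt C r p x = (if x \<in> V then INF y\<in>C. p (x + y) - r y else 0)"

text \<open>The infimum is finite: \<open>p y \<le> p (x + y) + p (- x)\<close> and \<open>r y \<le> p y\<close> bound it below by \<open>- p (- x)\<close>.
Subadditivity and homogeneity pass to the infimum because \<open>C\<close> is closed under sums and positive
multiples and \<open>r\<close> is superlinear there. The second claim with \<open>y = 0\<close> gives a functional below \<open>p\<close>, and
with \<open>x = - y\<close> the bound \<open>- r y\<close> at \<open>- y\<close>.\<close>

lemma tilt_sublinear: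
  assumes p: "sublinear p" and C: "subcone C" and r: "superlinear_on C r"
    and le: "\<forall>y\<in>C. r y \<le> p y"
  shows "sublinear (tilt C r p)"
    and "x \<in> V \<Longrightarrow> y \<in> C \<Longrightarrow> tilt C r p x \<le> p (x + y) - r y"
proof -
  have CV: "y \<in> V" if "y \<in> C" for y
    using C that by (auto simp: subcone_def)
  have C0: "C \<noteq> {}" "0 \<in> C"
    using C by (auto simp: subcone_def)
  have lower: "- p (- x) \<le> p (x + y) - r y" if x: "x \<in> V" and y: "y \<in> C" for x y
  proof -
    have "p ((x + y) + (- x)) \<le> p (x + y) + p (- x)"
      using p V_add[OF x CV[OF y]] V_neg[OF x] unfolding sublinear_def by blast
    then show ?thesis using le y by (simp add: algebra_simps, smt (verit))
  qed
  have upper: "tilt C r p x \<le> p (x + y) - r y" if x: "x \<in> V" and y: "y \<in> C" for x y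
    unfolding tilt_def using x lower
    by (auto intro!: cINF_lower2[OF _ y] bdd_belowI2)
  show "x \<in> V \<Longrightarrow> y \<in> C \<Longrightarrow> tilt C r p x \<le> p (x + y) - r y"
    by (rule upper)
  have p0: "p 0 = 0" and r0: "r 0 = 0"
    using p r by (auto simp: sublinear_def superlinear_on_def)
  show "sublinear (tilt C r p)"
    unfolding sublinear_def
  proof (intro conjI ballI allI impI)
    have "0 \<le> tilt C r p 0"
      using lower[OF V_zero] p0 V_zero C0 by (auto simp: tilt_def intro!: cINF_greatest)
    with upper[OF V_zero C0(2)] p0 r0 show "tilt C r p 0 = 0" by simp
  next
    fix x y assume x: "x \<in> V" and y: "y \<in> V"
    have "tilt C r p (x + y) \<le> (p (x + u) - r u) + (p (y + v) - r v)" if u: "u \<in> C" and v: "v \<in> C" for u v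
    proof -
      have "u + v \<in> C" "r u + r v \<le> r (u + v)"
        using C r u v by (auto simp: subcone_def superlinear_on_def)
      moreover have "p ((x + u) + (y + v)) \<le> p (x + u) + p (y + v)"
        using p x y u v CV V_add by (simp add: sublinear_def)
      ultimately show ?thesis
        using upper[OF V_add[OF x y], of "u + v"] by (simp add: algebra_simps)
    qed
    then show "tilt C r p (x + y) \<le> tilt C r p x + tilt C r p y"
      unfolding tilt_def[of C r p x] tilt_def[of C r p y] using x y C0
      by (auto intro!: le_cINF_add_cINF)
  next
    fix x and c :: real assume x: "x \<in> V" and c: "c > 0"
    have "tilt C r p (c \<odot> x) / c \<le> p (x + y) - r y" if y: "y \<in> C" for y
    proof -
      have "c \<odot> y \<in> C" "c * r y \<le> r (c \<odot> y)"
        using C r y c by (auto simp: subcone_def superlinear_on_def)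
      moreover have "p (c \<odot> x + c \<odot> y) \<le> c * p (x + y)"
        using p c V_add[OF x CV[OF y]] by (simp add: sublinear_def flip: scale_right_distrib)
      ultimately have "tilt C r p (c \<odot> x) \<le> c * p (x + y) - c * r y"
        using upper[OF V_scale[OF x], of "c \<odot> y" c] by simp
      then show ?thesis
        using c by (simp add: field_simps)
    qed
    then have "tilt C r p (c \<odot> x) / c \<le> tilt C r p x"
      unfolding tilt_def[of C r p x] using x C0 by (auto intro!: cINF_greatest)
    then show "tilt C r p (c \<odot> x) \<le> c * tilt C r p x"
      using c by (simp add: field_simps)
  qed
qed

definition sublinear_minorants :: "('b \<Rightarrow> real) \<Rightarrow> ('b \<Rightarrow> real) set" where
  "sublinear_minorants p = {q. sublinear q \<and> (\<forall>x\<in>V. q x \<le> p x) \<and> (\<forall>x. x \<notin> V \<longrightarrow> q x = 0)}"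

text \<open>The chain condition gives subadditivity of the infimum: two members \<open>q\<close>, \<open>q'\<close> used for \<open>x\<close> and for
\<open>y\<close> can both be replaced by the smaller one. Finiteness comes from the common bound \<open>- p (- x)\<close>.\<close>

lemma sublinear_Inf_chain:
  assumes K: "K \<subseteq> sublinear_minorants p" "K \<noteq> {}"
    and chain: "\<And>q q'. q \<in> K \<Longrightarrow> q' \<in> K \<Longrightarrow> q \<le> q' \<or> q' \<le> q"
  shows "(\<lambda>x. INF q\<in>K. q x) \<in> sublinear_minorants p"
    and "q \<in> K \<Longrightarrow> (INF q\<in>K. q x) \<le> q x"
proof -
  let ?u = "\<lambda>x. INF q\<in>K. q x"
  have Kq: "sublinear q" "x \<in> V \<Longrightarrow> q x \<le> p x" "x \<notin> V \<Longrightarrow> q x = 0" if "q \<in> K" for q x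
    using K that by (auto simp: sublinear_minorants_def)
  have "bdd_below ((\<lambda>q. q x) ` K)" for x
  proof (cases "x \<in> V")
    case True
    have "- p (- x) \<le> q x" if "q \<in> K" for q
      using sublinear_neg_le[OF Kq(1)[OF that] True] Kq(2)[OF that V_neg[OF True]] by simp
    then show ?thesis by (rule bdd_belowI2)
  next
    case False
    then have "0 \<le> q x" if "q \<in> K" for q using Kq(3)[OF that] by simp
    then show ?thesis by (rule bdd_belowI2)
  qed
  then have lower: "?u x \<le> q x" if "q \<in> K" for q x
    using that by (rule cINF_lower)
  then show "q \<in> K \<Longrightarrow> ?u x \<le> q x" .
  obtain q0 where q0: "q0 \<in> K" using K by blast
  have "sublinear ?u"
    unfolding sublinear_def
  proof (intro conjI ballI allI impI)
    have "(\<lambda>q. q 0) ` K = {0}"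
      using Kq(1) q0 by (force simp: sublinear_def)
    then show "?u 0 = 0" by simp
  next
    fix x y assume x: "x \<in> V" and y: "y \<in> V"
    have "?u (x + y) \<le> q x + q' y" if "q \<in> K" "q' \<in> K" for q q'
    proof -
      have "\<exists>m\<in>K. m \<le> q \<and> m \<le> q'"
        using chain that by blast
      then obtain m where m: "m \<in> K" "m x \<le> q x" "m y \<le> q' y"
        by (auto simp: le_fun_def)
      have "?u (x + y) \<le> m (x + y)" using lower m by blast
      also have "\<dots> \<le> m x + m y" using Kq(1)[OF m(1)] x y by (simp add: sublinear_def)
      finally show ?thesis using m by simp
    qed
    then show "?u (x + y) \<le> ?u x + ?u y"
      using K by (intro le_cINF_add_cINF) auto
  next
    fix x and c :: real assume x: "x \<in> V" and c: "c > 0"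
    have "?u (c \<odot> x) / c \<le> q x" if "q \<in> K" for q
      using lower[OF that, of "c \<odot> x"] sublinear_scale[OF Kq(1)[OF that] x, of c] c
      by (simp add: field_simps)
    then have "?u (c \<odot> x) / c \<le> ?u x"
      using K by (intro cINF_greatest) auto
    then show "?u (c \<odot> x) \<le> c * ?u x"
      using c by (simp add: field_simps)
  qed
  moreover have "?u x \<le> p x" if "x \<in> V" for x
    using lower[OF q0, of x] Kq(2)[OF q0 that] by simp
  moreover have "?u x = 0" if "x \<notin> V" for x
  proof -
    have "(\<lambda>q. q x) ` K = {0}"
      using Kq(3)[OF _ that] q0 by force
    then show ?thesis by simp
  qed
  ultimately show "?u \<in> sublinear_minorants p"
    by (simp add: sublinear_minorants_def)
qed

text \<open>Tilting \<open>q\<close> along the ray through \<open>y\<close>, with \<open>r = q\<close>, gives a smaller sublinear functional, which by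
minimality is \<open>q\<close> itself. The bound that it satisfies then reads \<open>q x \<le> q (x + y) - q y\<close>, the missing
half of additivity.\<close>

lemma minimal_sublinear_is_linear:
  assumes q: "sublinear q"
    and minimal: "\<And>q'. sublinear q' \<Longrightarrow> (\<And>x. x \<in> V \<Longrightarrow> q' x \<le> q x) \<Longrightarrow> (\<And>x. x \<notin> V \<Longrightarrow> q' x = 0)
      \<Longrightarrow> (\<And>x. x \<in> V \<Longrightarrow> q' x = q x)"
  shows "linear_functional q"
proof -
  have add: "q (x + y) = q x + q y" if x: "x \<in> V" and y: "y \<in> V" for x y
  proof -
    let ?R = "{t \<odot> y | t. t \<ge> 0}"
    have R: "subcone ?R"
      unfolding subcone_def
    proof (intro conjI ballI allI impI)
      show "?R \<subseteq> V" using V_scale y by auto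
      show "0 \<in> ?R" by (auto intro!: exI[of _ 0])
      show "a + b \<in> ?R" if "a \<in> ?R" "b \<in> ?R" for a b
        using that by (auto simp flip: scale_left_distrib)
      show "c \<odot> a \<in> ?R" if "a \<in> ?R" "c > 0" for a c
      proof -
        from that(1) obtain t where "t \<ge> 0" "a = t \<odot> y" by blast
        then have "0 \<le> c * t" "c \<odot> a = (c * t) \<odot> y" using that(2) by auto
        then show ?thesis by blast
      qed
    qed
    have r: "superlinear_on ?R q"
      unfolding superlinear_on_def
    proof (intro conjI ballI allI impI)
      show "q 0 = 0" using q by (simp add: sublinear_def)
      show "q a + q b \<le> q (a + b)" if "a \<in> ?R" "b \<in> ?R" for a b
      proof -
        from that obtain t u where "t \<ge> 0" "a = t \<odot> y" "u \<ge> 0" "b = u \<odot> y" by blast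
        then show ?thesis
          using sublinear_scale[OF q y, of t] sublinear_scale[OF q y, of u] sublinear_scale[OF q y, of "t + u"]
          by (simp add: scale_left_distrib distrib_right)
      qed
      show "c * q a \<le> q (c \<odot> a)" if "a \<in> ?R" "c > 0" for a c
        using sublinear_scale[OF q, of a c] that V_scale[OF y] by auto
    qed
    note T = tilt_sublinear[OF q R r ballI[OF order_refl]]
    have "0 \<in> ?R" using R by (simp add: subcone_def)
    then have "tilt ?R q q x = q x"
      using q T(2)[of _ 0] by (intro minimal T(1) x) (auto simp: sublinear_def tilt_def)
    moreover have "y \<in> ?R" by (auto intro!: exI[of _ 1])
    ultimately have "q x \<le> q (x + y) - q y"
      using T(2)[OF x, of y] by simp
    moreover have "q (x + y) \<le> q x + q y" using q x y by (simp add: sublinear_def)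
    ultimately show ?thesis by simp
  qed
  have neg: "q (- x) = - q x" if x: "x \<in> V" for x
    using add[OF x V_neg[OF x]] q by (simp add: sublinear_def)
  have "q (c \<odot> x) = c * q x" if x: "x \<in> V" for c x
  proof (cases "c \<ge> 0")
    case True
    then show ?thesis using sublinear_scale q x by blast
  next
    case False
    then have "q ((- c) \<odot> x) = - c * q x" by (intro sublinear_scale q x) simp
    then show ?thesis using neg[OF V_scale[OF x, of c]] by simp
  qed
  with add show ?thesis by (simp add: linear_functional_def)
qed

text \<open>Zorn's lemma, applied to the sublinear minorants of \<open>p\<close> under the reversed pointwise order, provides a
minimal one.\<close>

lemma sublinear_dominates_linear:
  assumes p: "sublinear p"
  obtains \<phi> where "linear_functional \<phi>" "\<And>x. x \<in> V \<Longrightarrow> \<phi> x \<le> p x"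
proof -
  let ?A = "sublinear_minorants p"
  let ?P = "\<lambda>q q' :: 'b \<Rightarrow> real. q' \<le> q"
  let ?p = "\<lambda>x. if x \<in> V then p x else 0"
  have pA: "?p \<in> ?A"
    using p V_zero V_add V_scale by (auto simp: sublinear_minorants_def sublinear_def)
  have "\<exists>m\<in>?A. \<forall>q\<in>?A. ?P m q \<longrightarrow> q = m"
  proof (rule predicate_Zorn)
    show "partial_order_on ?A (relation_of ?P ?A)"
      by (rule partial_order_on_relation_ofI) auto
  next
    fix K assume K: "K \<in> Chains (relation_of ?P ?A)"
    show "\<exists>u\<in>?A. \<forall>q\<in>K. ?P q u"
    proof (cases "K = {}")
      case True
      then show ?thesis using pA by blast
    next
      case False
      have KA: "K \<subseteq> ?A" and chain: "\<And>q q'. q \<in> K \<Longrightarrow> q' \<in> K \<Longrightarrow> q \<le> q' \<or> q' \<le> q"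
        using K by (auto simp: Chains_def relation_of_def)
      show ?thesis
        using sublinear_Inf_chain[OF KA False chain] by (intro bexI[of _ "\<lambda>x. INF q\<in>K. q x"]) (auto simp: le_fun_def)
    qed
  qed
  then obtain m where mA: "m \<in> ?A" and min: "\<And>q. q \<in> ?A \<Longrightarrow> q \<le> m \<Longrightarrow> q = m" by blast
  have m: "sublinear m" "\<And>x. x \<in> V \<Longrightarrow> m x \<le> p x" "\<And>x. x \<notin> V \<Longrightarrow> m x = 0"
    using mA by (auto simp: sublinear_minorants_def)
  have "linear_functional m"
  proof (rule minimal_sublinear_is_linear[OF m(1)])
    fix q x assume q: "sublinear q" "\<And>x. x \<in> V \<Longrightarrow> q x \<le> m x" "\<And>x. x \<notin> V \<Longrightarrow> q x = 0" and x: "x \<in> V"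
    have "q \<in> ?A"
      using q m(2) by (auto simp: sublinear_minorants_def intro: order_trans)
    moreover have "q \<le> m"
    proof (rule le_funI)
      show "q z \<le> m z" for z
        using q(2,3)[of z] m(3)[of z] by (cases "z \<in> V") auto
    qed
    ultimately show "q x = m x" using min by blast
  qed
  with m(2) that show ?thesis by blast
qed

text \<open>A linear functional below the tilted \<open>p\<close> is below \<open>p\<close>, and its value at \<open>- y\<close> is at most \<open>- r y\<close>; by
linearity this is \<open>r y \<le> \<phi> y\<close>.\<close>

theorem mazur_orlicz:
  assumes p: "sublinear p" and C: "subcone C" and r: "superlinear_on C r"
    and le: "\<forall>y\<in>C. r y \<le> p y"
  obtains \<phi> where "linear_functional \<phi>" "\<And>x. x \<in> V \<Longrightarrow> \<phi> x \<le> p x" "\<And>y. y \<in> C \<Longrightarrow> r y \<le> \<phi> y"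
proof -
  note T = tilt_sublinear[OF p C r le]
  obtain \<phi> where \<phi>: "linear_functional \<phi>" "\<And>x. x \<in> V \<Longrightarrow> \<phi> x \<le> tilt C r p x"
    using sublinear_dominates_linear[OF T(1)] by blast
  have "0 \<in> C" "r 0 = 0" using C r by (auto simp: subcone_def superlinear_on_def)
  then have "\<phi> x \<le> p x" if "x \<in> V" for x
    using \<phi>(2)[OF that] T(2)[OF that, of 0] by simp
  moreover have "r y \<le> \<phi> y" if y: "y \<in> C" for y
  proof -
    have yV: "y \<in> V" using C y by (auto simp: subcone_def)
    have "\<phi> (- y) \<le> - r y"
      using \<phi>(2)[OF V_neg[OF yV]] T(2)[OF V_neg[OF yV] y] p by (simp add: sublinear_def)
    moreover have "\<phi> ((- 1) \<odot> y) = - 1 * \<phi> y"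
      using \<phi>(1) yV unfolding linear_functional_def by blast
    ultimately show ?thesis by simp
  qed
  ultimately show thesis using that \<phi>(1) by blast
qed

end

section \<open>Measures squeezed between multiples of another measure\<close>

text \<open>The bound on sets is an inequality between \<open>N\<close> and the scaled measure \<open>s M\<close>, and the nonnegative
integral is monotone in the measure.\<close>

lemma
  fixes X :: "'a \<Rightarrow> real"
  assumes M: "finite_measure M" and N: "finite_measure N" and sets: "sets N = sets M"
    and le: "\<And>A. A \<in> sets M \<Longrightarrow> measure N A \<le> s * measure M A" and s: "s \<ge> 0"
    and X: "integrable M X"
  shows integrable_dominated_measure: "integrable N X"
    and integral_dominated_measure: "(\<And>\<omega>. 0 \<le> X \<omega>) \<Longrightarrow> (\<integral>\<omega>. X \<omega> \<partial>N) \<le> s * (\<integral>\<omega>. X \<omega> \<partial>M)"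
proof -
  interpret M: finite_measure M by fact
  interpret N: finite_measure N by fact
  have meas: "X \<in> borel_measurable N"
    using X sets by (simp cong: measurable_cong_sets)
  have "N \<le> scale_measure (ennreal s) M"
    using le s by (subst le_measure)
      (auto simp: sets M.emeasure_eq_measure N.emeasure_eq_measure simp flip: ennreal_mult intro!: ennreal_leI)
  then have nn: "(\<integral>\<^sup>+\<omega>. f \<omega> \<partial>N) \<le> ennreal s * (\<integral>\<^sup>+\<omega>. f \<omega> \<partial>M)"
    if "f \<in> borel_measurable M" for f :: "'a \<Rightarrow> ennreal"
    using nn_integral_mono_measure[of N "scale_measure (ennreal s) M" f] that
    by (simp add: sets nn_integral_scale_measure)
  have "(\<integral>\<^sup>+\<omega>. ennreal (norm (X \<omega>)) \<partial>N) \<le> ennreal s * (\<integral>\<^sup>+\<omega>. ennreal (norm (X \<omega>)) \<partial>M)"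
    using X by (intro nn) simp
  also have "\<dots> < \<infinity>"
    using X by (simp add: integrable_iff_bounded ennreal_mult_less_top)
  finally show N_int: "integrable N X"
    using meas by (simp add: integrable_iff_bounded)
  assume nonneg: "\<And>\<omega>. 0 \<le> X \<omega>"
  have "ennreal (\<integral>\<omega>. X \<omega> \<partial>N) \<le> ennreal (s * (\<integral>\<omega>. X \<omega> \<partial>M))"
    using nn[of "\<lambda>\<omega>. ennreal (X \<omega>)"] X N_int nonneg s
    by (simp add: nn_integral_eq_integral ennreal_mult)
  then show "(\<integral>\<omega>. X \<omega> \<partial>N) \<le> s * (\<integral>\<omega>. X \<omega> \<partial>M)"
    using nonneg s by (subst (asm) ennreal_le_iff) (auto intro!: mult_nonneg_nonneg integral_nonneg)
qed

section \<open>Bounded positive functionals on integrable functions are measures\<close>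

lemma real_subspace_integrable:
  "real_subspace (\<lambda>c f \<omega>. c * f \<omega>) {X :: 'a \<Rightarrow> real. integrable M X}"
proof -
  interpret vector_space "\<lambda>c (f :: 'a \<Rightarrow> real) \<omega>. c * f \<omega>"
    by unfold_locales (auto simp: fun_eq_iff algebra_simps)
  show ?thesis
    by unfold_locales (auto simp: subspace_def plus_fun_def zero_fun_def)
qed

text \<open>A form of the Riesz representation theorem for \<open>L\<^sup>1\<close>. The bound by \<open>C\<close> times the \<open>L\<^sup>1\<close> norm is
used twice. On indicators it makes \<open>A \<mapsto> \<phi>(1\<^sub>A)\<close> continuous at the empty set, hence
\<open>\<sigma>\<close>-additive. On differences it makes \<open>\<phi>\<close> continuous under dominated convergence, so that the identity
of \<open>\<phi>\<close> and the integral extends from indicators to all integrable functions.\<close>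

lemma (in finite_measure) bounded_positive_functional_is_integral:
  fixes \<phi> :: "('a \<Rightarrow> real) \<Rightarrow> real"
  assumes add: "\<And>X Y. integrable M X \<Longrightarrow> integrable M Y \<Longrightarrow> \<phi> (\<lambda>\<omega>. X \<omega> + Y \<omega>) = \<phi> X + \<phi> Y"
    and scale: "\<And>X c. integrable M X \<Longrightarrow> \<phi> (\<lambda>\<omega>. c * X \<omega>) = c * \<phi> X"
    and bound: "\<And>X. integrable M X \<Longrightarrow> \<phi> X \<le> C * (\<integral>\<omega>. \<bar>X \<omega>\<bar> \<partial>M)"
    and pos: "\<And>A. A \<in> sets M \<Longrightarrow> 0 \<le> \<phi> (indicator A)"
    and C: "C \<ge> 0"
  obtains N where "finite_measure N" "sets N = sets M"
    "\<And>A. A \<in> sets M \<Longrightarrow> measure N A = \<phi> (indicator A)"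
    "\<And>X. integrable M X \<Longrightarrow> integrable N X \<and> (\<integral>\<omega>. X \<omega> \<partial>N) = \<phi> X"
proof -
  have ind: "integrable M (indicator A :: 'a \<Rightarrow> real)" if "A \<in> sets M" for A
    using that by (simp add: emeasure_eq_measure)
  have zero: "\<phi> (\<lambda>_. 0) = 0"
    using scale[of "\<lambda>_. 0" 0] by simp
  have le: "\<phi> (indicator A) \<le> C * measure M A" if "A \<in> sets M" for A
    using bound[OF ind[OF that]] that by simp
  have Un: "\<phi> (indicator (A \<union> B)) = \<phi> (indicator A) + \<phi> (indicator B)"
    if "A \<in> sets M" "B \<in> sets M" "A \<inter> B = {}" for A B
  proof -
    have "(indicator (A \<union> B) :: 'a \<Rightarrow> real) = (\<lambda>\<omega>. indicator A \<omega> + indicator B \<omega>)"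
      using that(3) by (auto simp: fun_eq_iff indicator_def)
    then show ?thesis using add[OF ind ind] that by simp
  qed
  define \<mu> where "\<mu> A = ennreal (\<phi> (indicator A))" for A
  define N where "N = measure_of (space M) (sets M) \<mu>"
  have sets_N: "sets N = sets M" and space_N: "space N = space M"
    by (auto simp: N_def)
  have positive: "positive (sets M) \<mu>"
    using zero by (simp add: positive_def \<mu>_def indicator_def[abs_def])
  have "countably_additive (sets M) \<mu>"
  proof (rule sets.empty_continuous_imp_countably_additive[OF positive])
    show "additive (sets M) \<mu>"
      using pos Un by (auto simp: additive_def \<mu>_def simp flip: ennreal_plus)
    show "\<forall>A\<in>sets M. \<mu> A \<noteq> \<infinity>"
      by (simp add: \<mu>_def)
    fix A :: "nat \<Rightarrow> 'a set"
    assume A: "range A \<subseteq> sets M" "decseq A" "(\<Inter>i. A i) = {}"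
    have "(\<lambda>i. measure M (A i)) \<longlonglongrightarrow> 0"
      using finite_Lim_measure_decseq[OF A(1,2)] A(3) by simp
    then have "(\<lambda>i. C * measure M (A i)) \<longlonglongrightarrow> 0"
      by (rule tendsto_mult_right_zero)
    then have "(\<lambda>i. \<phi> (indicator (A i))) \<longlonglongrightarrow> 0"
      by (rule tendsto_sandwich[OF _ _ tendsto_const, rotated 2]) (use A(1) pos le in \<open>auto intro!: always_eventually\<close>)
    then show "(\<lambda>i. \<mu> (A i)) \<longlonglongrightarrow> 0"
      unfolding \<mu>_def by (simp add: tendsto_ennreal_iff pos A(1) flip: ennreal_0)
  qed
  then have emeasure_N: "emeasure N A = \<mu> A" if "A \<in> sets M" for A
    unfolding N_def using that positive
    by (intro emeasure_measure_of_sigma) (auto simp: sets.sigma_algebra_axioms)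
  have N_fin: "finite_measure N"
    by (intro finite_measureI) (simp add: space_N emeasure_N \<mu>_def)
  have measure_N: "measure N A = \<phi> (indicator A)" if "A \<in> sets M" for A
    using that pos by (simp add: measure_def emeasure_N \<mu>_def)
  have N_int: "integrable N X" if "integrable M X" for X :: "'a \<Rightarrow> real"
    using le measure_N by (intro integrable_dominated_measure[OF finite_measure_axioms N_fin sets_N _ C that]) simp
  have "(\<integral>\<omega>. X \<omega> \<partial>N) = \<phi> X" if "integrable M X" for X
    using that
  proof (induction rule: integrable_induct)
    case (base A c)
    have "\<phi> (\<lambda>\<omega>. indicator A \<omega> *\<^sub>R c) = c * \<phi> (indicator A)"
      using scale[OF ind[OF base(1)], of c] by (simp add: mult.commute)
    then show ?case
      using base(1) measure_N by (simp add: sets_N)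
  next
    case (add f g)
    then show ?case
      using N_int assms(1) by simp
  next
    case (lim f s)
    have [measurable]: "f \<in> borel_measurable M" "\<And>i. s i \<in> borel_measurable M"
      using lim by auto
    have abs_bound: "\<bar>\<phi> X - \<phi> Y\<bar> \<le> C * (\<integral>\<omega>. \<bar>X \<omega> - Y \<omega>\<bar> \<partial>M)"
      if X: "integrable M X" and Y: "integrable M Y" for X Y
    proof -
      have diff: "\<phi> (\<lambda>\<omega>. X \<omega> - Y \<omega>) = \<phi> X - \<phi> Y" if "integrable M X" "integrable M Y" for X Y
        using assms(1)[of X "\<lambda>\<omega>. - 1 * Y \<omega>"] scale[of Y "- 1"] that by simp
      show ?thesis
        using bound[of "\<lambda>\<omega>. X \<omega> - Y \<omega>"] bound[of "\<lambda>\<omega>. Y \<omega> - X \<omega>"] diff[OF X Y] diff[OF Y X] X Y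
        by (simp add: abs_minus_commute)
    qed
    have "(\<lambda>i. \<integral>\<omega>. \<bar>s i \<omega> - f \<omega>\<bar> \<partial>M) \<longlonglongrightarrow> (\<integral>\<omega>. 0 \<partial>M)"
    proof (rule integral_dominated_convergence[where w="\<lambda>\<omega>. 3 * \<bar>f \<omega>\<bar>"])
      show "AE \<omega> in M. (\<lambda>i. \<bar>s i \<omega> - f \<omega>\<bar>) \<longlonglongrightarrow> 0"
        using lim(2) by (auto intro!: AE_I2 tendsto_rabs_zero LIM_zero)
      \<comment> \<open>The approximating functions satisfy \<open>\<bar>s i\<bar> \<le> 2 \<bar>f\<bar>\<close>, whence the constant \<open>3\<close>.\<close>
      show "AE \<omega> in M. norm \<bar>s i \<omega> - f \<omega>\<bar> \<le> 3 * \<bar>f \<omega>\<bar>" for i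
      proof (rule AE_I2)
        fix \<omega> assume "\<omega> \<in> space M"
        from lim(3)[OF this, of i] show "norm \<bar>s i \<omega> - f \<omega>\<bar> \<le> 3 * \<bar>f \<omega>\<bar>" by simp
      qed
    qed (use lim in auto)
    then have "(\<lambda>i. C * (\<integral>\<omega>. \<bar>s i \<omega> - f \<omega>\<bar> \<partial>M)) \<longlonglongrightarrow> 0"
      by (auto intro: tendsto_mult_right_zero)
    then have "(\<lambda>i. \<phi> (s i) - \<phi> f) \<longlonglongrightarrow> 0"
      by (rule Lim_null_comparison[rotated]) (use abs_bound lim in \<open>auto intro!: always_eventually\<close>)
    then have "(\<lambda>i. \<phi> (s i)) \<longlonglongrightarrow> \<phi> f"
      by (simp add: LIM_zero_iff)
    moreover have "(\<lambda>i. \<integral>\<omega>. s i \<omega> \<partial>N) \<longlonglongrightarrow> (\<integral>\<omega>. f \<omega> \<partial>N)"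
      using lim N_int by (intro integral_dominated_convergence[where w="\<lambda>\<omega>. 2 * norm (f \<omega>)"])
        (auto simp: space_N intro!: AE_I2 borel_measurable_integrable)
    ultimately show ?case
      using lim by (auto intro: LIMSEQ_unique)
  qed
  with that N_fin sets_N measure_N N_int show thesis by blast
qed

section \<open>Equivalent super-martingale measures\<close>

lemma convex_cone_of_rvsD:
  fixes L :: "('a \<Rightarrow> real) set"
  assumes L: "convex_cone_of_rvs M L"
  shows "X \<in> L \<Longrightarrow> 0 \<le> c \<Longrightarrow> (\<lambda>\<omega>. c * X \<omega>) \<in> L"
    and "X \<in> L \<Longrightarrow> Y \<in> L \<Longrightarrow> (\<lambda>\<omega>. X \<omega> + Y \<omega>) \<in> L"
proof -
  have comb: "(\<lambda>\<omega>. \<Sum>j=1..n. d j * Z j \<omega>) \<in> L"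
    if "n \<ge> 1" "\<forall>j\<in>{1..n}. 0 \<le> d j \<and> Z j \<in> L" for n :: nat and d :: "nat \<Rightarrow> real" and Z
    using L[unfolded convex_cone_of_rvs_def, THEN conjunct2, rule_format, of n d Z] that by blast
  show "X \<in> L \<Longrightarrow> 0 \<le> c \<Longrightarrow> (\<lambda>\<omega>. c * X \<omega>) \<in> L"
    using comb[of 1 "\<lambda>_. c" "\<lambda>_. X"] by simp
  have two: "{Suc 0..2} = {1, 2}" by auto
  show "X \<in> L \<Longrightarrow> Y \<in> L \<Longrightarrow> (\<lambda>\<omega>. X \<omega> + Y \<omega>) \<in> L"
    using comb[of 2 "\<lambda>_. 1" "\<lambda>j. if j = 1 then X else Y"] by (simp add: two)
qed

lemma sublinear_integral_max:
  fixes c :: real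
  shows "real_subspace.sublinear (\<lambda>c f \<omega>. c * f \<omega>) {X. integrable M X}
    (\<lambda>X. \<integral>\<omega>. max (X \<omega>) (c * X \<omega>) \<partial>M)"
proof -
  interpret real_subspace "\<lambda>c f \<omega>. c * f \<omega>" "{X :: 'a \<Rightarrow> real. integrable M X}"
    by (rule real_subspace_integrable)
  show ?thesis
    unfolding sublinear_def
  proof (intro conjI ballI allI impI; (unfold mem_Collect_eq)?)
    show "(\<integral>\<omega>. max ((0 :: 'a \<Rightarrow> real) \<omega>) (c * (0 :: 'a \<Rightarrow> real) \<omega>) \<partial>M) = 0"
      by simp
  next
    fix X Y :: "'a \<Rightarrow> real" assume XY: "integrable M X" "integrable M Y"
    then have "(\<integral>\<omega>. max ((X + Y) \<omega>) (c * (X + Y) \<omega>) \<partial>M) \<le>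
        (\<integral>\<omega>. max (X \<omega>) (c * X \<omega>) + max (Y \<omega>) (c * Y \<omega>) \<partial>M)"
      by (intro integral_mono) (auto simp: distrib_left)
    then show "(\<integral>\<omega>. max ((X + Y) \<omega>) (c * (X + Y) \<omega>) \<partial>M) \<le>
        (\<integral>\<omega>. max (X \<omega>) (c * X \<omega>) \<partial>M) + (\<integral>\<omega>. max (Y \<omega>) (c * Y \<omega>) \<partial>M)"
      using XY by simp
  next
    fix X :: "'a \<Rightarrow> real" and t :: real assume "integrable M X" "t > 0"
    then show "(\<integral>\<omega>. max (t * X \<omega>) (c * (t * X \<omega>)) \<partial>M) \<le> t * (\<integral>\<omega>. max (X \<omega>) (c * X \<omega>) \<partial>M)"
      by (simp add: max_mult_distrib_left mult.left_commute flip: integral_mult_right_zero)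
  qed
qed

text \<open>This carries the theorem: the separation argument in \<open>L\<^sup>1(Q)\<close>, followed by the representation of
the separating functional as a measure.\<close>

lemma supermartingale_measure_exists:
  assumes Q: "prob_space Q" and L: "convex_cone_of_rvs Q L" and k: "k \<ge> 0"
    and hyp: "\<And>X. X \<in> L \<Longrightarrow> integrable Q X \<and> (\<integral>\<omega>. X \<omega> \<partial>Q) \<le> k * (\<integral>\<omega>. neg_part X \<omega> \<partial>Q)"
  obtains P where "prob_space P" "sets P = sets Q"
    "\<And>A. A \<in> sets Q \<Longrightarrow> measure Q A / (1 + k) \<le> measure P A \<and> measure P A \<le> (1 + k) * measure Q A"
    "\<And>X. X \<in> L \<Longrightarrow> integrable P X \<and> (\<integral>\<omega>. X \<omega> \<partial>P) \<le> 0"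
proof -
  interpret Q: prob_space Q by fact
  interpret L1: real_subspace "\<lambda>c f \<omega>. c * f \<omega>" "{X :: 'a \<Rightarrow> real. integrable Q X}"
    by (rule real_subspace_integrable)
  define c where "c = 1 + k"
  have c: "c \<ge> 1" using k by (simp add: c_def)
  define p where "p X = (\<integral>\<omega>. max (X \<omega>) (c * X \<omega>) \<partial>Q)" for X :: "'a \<Rightarrow> real"
  have p_sub: "L1.sublinear p"
    unfolding p_def by (rule sublinear_integral_max)
  \<comment> \<open>An empty \<open>L\<close> counts as a cone but lacks the zero function, which is therefore adjoined.\<close>
  let ?C = "{Y. - Y \<in> insert 0 L}"
  have cone: "L1.subcone ?C"
    unfolding L1.subcone_def
  proof (intro conjI ballI allI impI subsetI; (unfold mem_Collect_eq)?)
    fix Y assume "- Y \<in> insert 0 L"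
    then have "integrable Q (- Y)" using hyp by (auto simp: zero_fun_def)
    then show "integrable Q Y"
      by (simp add: fun_Compl_def)
  next
    show "- 0 \<in> insert 0 L" by simp
  next
    fix X Y assume "- X \<in> insert 0 L" "- Y \<in> insert 0 L"
    moreover have "- X + - Y \<in> L" if "- X \<in> L" "- Y \<in> L"
      unfolding plus_fun_def using that by (rule convex_cone_of_rvsD(2)[OF L])
    ultimately have "- X + - Y \<in> insert 0 L"
      by (elim insertE) simp_all
    then show "- (X + Y) \<in> insert 0 L" by simp
  next
    fix X and t :: real assume "- X \<in> insert 0 L" "t > 0"
    then have "(\<lambda>\<omega>. t * (- X) \<omega>) \<in> insert 0 L"
    proof (elim insertE)
      assume "- X = 0"
      then have "X = 0" by simp
      then show ?thesis by (simp add: zero_fun_def)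
    next
      assume "- X \<in> L"
      then show ?thesis using convex_cone_of_rvsD(1)[OF L, of "- X" t] \<open>t > 0\<close> by simp
    qed
    then show "- (\<lambda>\<omega>. t * X \<omega>) \<in> insert 0 L" by (simp add: fun_Compl_def)
  qed
  \<comment> \<open>The only place where the bound \<open>E(X) \<le> k E(X\<^sup>-)\<close> enters: for \<open>X = - Y \<in> L\<close> it says \<open>p Y \<ge> 0\<close>.\<close>
  have p_nonneg: "0 \<le> p Y" if "Y \<in> ?C" for Y
  proof (cases "Y = 0")
    case True
    then show ?thesis by (simp add: p_def)
  next
    case False
    with that have X: "- Y \<in> L" by auto
    have "(\<lambda>\<omega>. max (Y \<omega>) (c * Y \<omega>)) = (\<lambda>\<omega>. k * neg_part (- Y) \<omega> - (- Y) \<omega>)"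
      using k by (auto simp: fun_eq_iff neg_part_def c_def max_def algebra_simps mult_le_0_iff zero_le_mult_iff)
    moreover have "integrable Q Y" using hyp[OF X] by (simp add: fun_Compl_def)
    ultimately have "p Y = k * (\<integral>\<omega>. neg_part (- Y) \<omega> \<partial>Q) - (\<integral>\<omega>. (- Y) \<omega> \<partial>Q)"
      unfolding p_def by (simp add: neg_part_def)
    then show ?thesis using hyp[OF X] by simp
  qed
  obtain \<phi> where \<phi>: "L1.linear_functional \<phi>" and \<phi>_le: "\<And>X. integrable Q X \<Longrightarrow> \<phi> X \<le> p X"
    and \<phi>_C: "\<And>Y. Y \<in> ?C \<Longrightarrow> 0 \<le> \<phi> Y"
    using L1.mazur_orlicz[OF p_sub cone, of "\<lambda>_. 0"] p_nonneg by (auto simp: L1.superlinear_on_def)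
  have add: "\<phi> (\<lambda>\<omega>. X \<omega> + Y \<omega>) = \<phi> X + \<phi> Y" if "integrable Q X" "integrable Q Y" for X Y
    using \<phi> that by (simp add: L1.linear_functional_def plus_fun_def)
  have scale: "\<phi> (\<lambda>\<omega>. t * X \<omega>) = t * \<phi> X" if "integrable Q X" for X t
    using \<phi> that by (simp add: L1.linear_functional_def)
  have ind: "integrable Q (indicator A :: 'a \<Rightarrow> real)" if "A \<in> sets Q" for A
    using that by (simp add: Q.emeasure_eq_measure)
  \<comment> \<open>The two bounds on indicators are \<open>\<phi> \<le> p\<close> at \<open>1\<^sub>A\<close> and at \<open>- 1\<^sub>A\<close>.\<close>
  have ind_le: "\<phi> (indicator A) \<le> c * measure Q A" if "A \<in> sets Q" for A
  proof -
    have "(\<lambda>\<omega>. max (indicator A \<omega>) (c * indicator A \<omega>)) = (\<lambda>\<omega>. c * indicator A \<omega> :: real)"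
      using c by (auto simp: fun_eq_iff indicator_def)
    then show ?thesis using \<phi>_le[OF ind[OF that]] that by (simp add: p_def)
  qed
  have ind_ge: "measure Q A \<le> \<phi> (indicator A)" if "A \<in> sets Q" for A
  proof -
    have "(\<lambda>\<omega>. max (- 1 * indicator A \<omega>) (c * (- 1 * indicator A \<omega>))) = (\<lambda>\<omega>. - indicator A \<omega> :: real)"
      using c by (auto simp: fun_eq_iff indicator_def)
    then have "p (\<lambda>\<omega>. - 1 * indicator A \<omega>) = - measure Q A"
      using that unfolding p_def by simp
    then show ?thesis
      using \<phi>_le[of "\<lambda>\<omega>. - 1 * indicator A \<omega>"] scale[OF ind[OF that], of "- 1"] ind[OF that] by simp
  qed
  \<comment> \<open>The total mass of the measure represented by \<open>\<phi>\<close>, by which it is normalised.\<close>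
  define m where "m = \<phi> (indicator (space Q))"
  have m: "1 \<le> m" "m \<le> c"
    using ind_le[of "space Q"] ind_ge[of "space Q"] by (auto simp: m_def Q.prob_space)
  have bound: "\<phi> X / m \<le> c * (\<integral>\<omega>. \<bar>X \<omega>\<bar> \<partial>Q)" if X: "integrable Q X" for X
  proof -
    have "p X \<le> (\<integral>\<omega>. c * \<bar>X \<omega>\<bar> \<partial>Q)"
      unfolding p_def
    proof (rule integral_mono)
      fix \<omega>
      have "\<bar>X \<omega>\<bar> \<le> c * \<bar>X \<omega>\<bar>" using c mult_right_mono[of 1 c "\<bar>X \<omega>\<bar>"] by simp
      moreover have "c * X \<omega> \<le> c * \<bar>X \<omega>\<bar>" using c by simp
      ultimately show "max (X \<omega>) (c * X \<omega>) \<le> c * \<bar>X \<omega>\<bar>" by simp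
    qed (use X in auto)
    then have "\<phi> X \<le> c * (\<integral>\<omega>. \<bar>X \<omega>\<bar> \<partial>Q)" using \<phi>_le[OF X] X by simp
    moreover have "0 \<le> c * (\<integral>\<omega>. \<bar>X \<omega>\<bar> \<partial>Q)" using c by simp
    then have "c * (\<integral>\<omega>. \<bar>X \<omega>\<bar> \<partial>Q) \<le> c * (\<integral>\<omega>. \<bar>X \<omega>\<bar> \<partial>Q) * m"
      using m mult_left_mono[of 1 m] by fastforce
    ultimately have "\<phi> X \<le> c * (\<integral>\<omega>. \<bar>X \<omega>\<bar> \<partial>Q) * m"
      by linarith
    then show ?thesis using m by (simp add: pos_divide_le_eq)
  qed
  obtain P where P: "finite_measure P" "sets P = sets Q"
      "\<And>A. A \<in> sets Q \<Longrightarrow> measure P A = \<phi> (indicator A) / m"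
      "\<And>X. integrable Q X \<Longrightarrow> integrable P X \<and> (\<integral>\<omega>. X \<omega> \<partial>P) = \<phi> X / m"
  proof (rule Q.bounded_positive_functional_is_integral[of "\<lambda>X. \<phi> X / m" c])
    show "0 \<le> \<phi> (indicator A) / m" if "A \<in> sets Q" for A
      using ind_ge[OF that] m by (intro divide_nonneg_pos) (auto intro: order_trans[OF measure_nonneg])
  qed (use add scale bound c in \<open>auto simp: add_divide_distrib\<close>)
  have space_P: "space P = space Q" using P(2) by (rule sets_eq_imp_space_eq)
  interpret P: finite_measure P by fact
  show thesis
  proof
    show "prob_space P"
      using P(3)[of "space Q"] m by (intro prob_spaceI) (simp add: P.emeasure_eq_measure space_P m_def)
    show "sets P = sets Q" by fact
    show "measure Q A / (1 + k) \<le> measure P A \<and> measure P A \<le> (1 + k) * measure Q A"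
      if A: "A \<in> sets Q" for A
    proof
      have "measure Q A / c \<le> \<phi> (indicator A) / m"
        using ind_ge[OF A] m by (intro frac_le) (auto intro: order_trans[OF measure_nonneg])
      then show "measure Q A / (1 + k) \<le> measure P A" by (simp add: P(3) A c_def)
      have "\<phi> (indicator A) / m \<le> (c * measure Q A) / 1"
        using ind_le[OF A] m c by (intro frac_le) auto
      then show "measure P A \<le> (1 + k) * measure Q A" by (simp add: P(3) A c_def)
    qed
    show "integrable P X \<and> (\<integral>\<omega>. X \<omega> \<partial>P) \<le> 0" if X: "X \<in> L" for X
    proof -
      have int: "integrable Q X" using hyp X by blast
      have "0 \<le> \<phi> (- X)" using X by (intro \<phi>_C) simp
      also have "\<phi> (- X) = - \<phi> X"
        using scale[OF int, of "- 1"] by (simp add: fun_Compl_def)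
      finally have "\<phi> X / m \<le> 0" using m by (simp add: divide_nonpos_pos)
      with P(4)[OF int] show ?thesis by simp
    qed
  qed
qed

lemma null_sets_eq_of_bounds:
  assumes P: "finite_measure P" and Q: "finite_measure Q" and sets: "sets P = sets Q" and r: "0 < r"
    and bounds: "\<And>A. A \<in> sets Q \<Longrightarrow> r * measure Q A \<le> measure P A \<and> measure P A \<le> s * measure Q A"
  shows "null_sets P = null_sets Q"
proof -
  interpret P: finite_measure P by fact
  interpret Q: finite_measure Q by fact
  have "measure P A = 0 \<longleftrightarrow> measure Q A = 0" if "A \<in> sets Q" for A
    using bounds[OF that] r measure_nonneg[of P A] measure_nonneg[of Q A]
    by (auto simp: mult_le_0_iff intro!: antisym)
  then show ?thesis
    by (auto simp: null_sets_def sets P.emeasure_eq_measure Q.emeasure_eq_measure)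
qed

text \<open>Chain the comparisons \<open>E\<^sub>M(X\<^sup>+) \<le> E\<^sub>P(X\<^sup>+) / r\<close>, \<open>E\<^sub>P(X\<^sup>+) \<le> E\<^sub>P(X\<^sup>-)\<close> and
\<open>E\<^sub>P(X\<^sup>-) \<le> s E\<^sub>M(X\<^sup>-)\<close>, then subtract \<open>E\<^sub>M(X\<^sup>-)\<close>.\<close>

lemma integral_le_neg_part_of_supermartingale:
  fixes X :: "'a \<Rightarrow> real"
  assumes P: "prob_space P" and M: "prob_space M" and sets: "sets P = sets M"
    and r: "0 < r" and s: "0 \<le> s"
    and bounds: "\<And>A. A \<in> sets M \<Longrightarrow> r * measure M A \<le> measure P A \<and> measure P A \<le> s * measure M A"
    and X: "integrable P X" "(\<integral>\<omega>. X \<omega> \<partial>P) \<le> 0"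
  shows "integrable M X" and "(\<integral>\<omega>. X \<omega> \<partial>M) \<le> (s / r - 1) * (\<integral>\<omega>. neg_part X \<omega> \<partial>M)"
proof -
  have fin: "finite_measure P" "finite_measure M"
    using P M by (auto simp: prob_space_def)
  have le: "measure M A \<le> (1 / r) * measure P A" if "A \<in> sets P" for A
    using bounds[of A] that r sets by (simp add: field_simps)
  have r': "0 \<le> 1 / r" using r by simp
  show XM: "integrable M X"
    by (rule integrable_dominated_measure[OF fin sets[symmetric] le r' X(1)])
  have parts: "(\<lambda>\<omega>. X \<omega>) = (\<lambda>\<omega>. max (X \<omega>) 0 - neg_part X \<omega>)"
    by (auto simp: neg_part_def fun_eq_iff)
  have split: "(\<integral>\<omega>. X \<omega> \<partial>N) = (\<integral>\<omega>. max (X \<omega>) 0 \<partial>N) - (\<integral>\<omega>. neg_part X \<omega> \<partial>N)"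
    if "integrable N X" for N
    using that by (subst parts) (auto simp: neg_part_def)
  have "(\<integral>\<omega>. max (X \<omega>) 0 \<partial>M) \<le> (1 / r) * (\<integral>\<omega>. max (X \<omega>) 0 \<partial>P)"
    using X by (intro integral_dominated_measure[OF fin sets[symmetric] le r']) auto
  also have "\<dots> \<le> (1 / r) * (\<integral>\<omega>. neg_part X \<omega> \<partial>P)"
    using split[OF X(1)] X(2) r' by (intro mult_left_mono) auto
  also have "\<dots> \<le> (1 / r) * (s * (\<integral>\<omega>. neg_part X \<omega> \<partial>M))"
    using XM bounds s r' by (intro mult_left_mono integral_dominated_measure[OF fin(2,1) sets])
      (auto simp: neg_part_def)
  finally show "(\<integral>\<omega>. X \<omega> \<partial>M) \<le> (s / r - 1) * (\<integral>\<omega>. neg_part X \<omega> \<partial>M)"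
    using split[OF XM] by (simp add: algebra_simps)
qed

theorem theorem6:
  fixes P0 :: "'a measure" and L :: "('a \<Rightarrow> real) set"
  assumes "prob_space P0" and "convex_cone_of_rvs P0 L"
  shows "((\<exists>P. ESM P0 L P) \<longleftrightarrow>
           (\<exists>Q. equivalent_prob P0 Q \<and>
             (\<exists>k\<ge>0. \<forall>X\<in>L. integrable Q X \<and>
                (\<integral>\<omega>. X \<omega> \<partial>Q) \<le> k * (\<integral>\<omega>. neg_part X \<omega> \<partial>Q)))) \<and>
         ((\<exists>P r s. ESM P0 L P \<and> 0 < r \<and> r \<le> s \<and>
             (\<forall>A\<in>sets P0. r * measure P0 A \<le> measure P A \<and>
                           measure P A \<le> s * measure P0 A)) \<longleftrightarrow>
           (\<exists>k\<ge>0. \<forall>X\<in>L. integrable P0 X \<and>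
              (\<integral>\<omega>. X \<omega> \<partial>P0) \<le> k * (\<integral>\<omega>. neg_part X \<omega> \<partial>P0)))"
proof -
  have ESM_from_bound: "\<exists>P r s. ESM P0 L P \<and> 0 < r \<and> r \<le> s \<and>
      (\<forall>A\<in>sets Q. r * measure Q A \<le> measure P A \<and> measure P A \<le> s * measure Q A)"
    if Q: "equivalent_prob P0 Q" and k: "k \<ge> 0" and bound: "\<forall>X\<in>L. integrable Q X \<and>
      (\<integral>\<omega>. X \<omega> \<partial>Q) \<le> k * (\<integral>\<omega>. neg_part X \<omega> \<partial>Q)" for Q k
  proof -
    have Q': "prob_space Q" "sets Q = sets P0" "null_sets Q = null_sets P0"
      using Q by (auto simp: equivalent_prob_def)
    have "convex_cone_of_rvs Q L"
      using assms(2) Q'(2) by (simp add: convex_cone_of_rvs_def cong: measurable_cong_sets)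
    then obtain P where P: "prob_space P" "sets P = sets Q"
        "\<And>A. A \<in> sets Q \<Longrightarrow> measure Q A / (1 + k) \<le> measure P A \<and> measure P A \<le> (1 + k) * measure Q A"
        "\<And>X. X \<in> L \<Longrightarrow> integrable P X \<and> (\<integral>\<omega>. X \<omega> \<partial>P) \<le> 0"
      using supermartingale_measure_exists[OF Q'(1) _ k] bound by blast
    have bounds: "1 / (1 + k) * measure Q A \<le> measure P A \<and> measure P A \<le> (1 + k) * measure Q A"
      if "A \<in> sets Q" for A
      using P(3)[OF that] by simp
    have "null_sets P = null_sets Q"
      using P(1,2) Q'(1) k bounds by (intro null_sets_eq_of_bounds[where r="1 / (1 + k)" and s="1 + k"])
        (auto simp: prob_space_def)
    then have "ESM P0 L P"
      using P Q' by (simp add: ESM_def equivalent_prob_def)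
    moreover have "1 / (1 + k) \<le> 1 + k" "0 < 1 / (1 + k)"
      using k by (auto simp: field_simps)
    ultimately show ?thesis using bounds by blast
  qed
  have bound_from_ESM: "equivalent_prob P0 P \<and> (\<exists>k\<ge>0. \<forall>X\<in>L. integrable P X \<and>
      (\<integral>\<omega>. X \<omega> \<partial>P) \<le> k * (\<integral>\<omega>. neg_part X \<omega> \<partial>P))" if "ESM P0 L P" for P
    using that by (intro conjI exI[of _ 0]) (simp_all add: ESM_def)
  have bound_from_comparable_ESM: "\<exists>k\<ge>0. \<forall>X\<in>L. integrable P0 X \<and> (\<integral>\<omega>. X \<omega> \<partial>P0) \<le> k * (\<integral>\<omega>. neg_part X \<omega> \<partial>P0)"
    if P: "ESM P0 L P" and rs: "0 < r" "r \<le> s" and bounds: "\<forall>A\<in>sets P0.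
      r * measure P0 A \<le> measure P A \<and> measure P A \<le> s * measure P0 A" for P r s
  proof (intro exI[of _ "s / r - 1"] conjI ballI)
    show "0 \<le> s / r - 1" using rs by simp
    fix X assume "X \<in> L"
    with P have *: "prob_space P" "sets P = sets P0" "integrable P X" "(\<integral>\<omega>. X \<omega> \<partial>P) \<le> 0"
      by (auto simp: ESM_def equivalent_prob_def)
    show "integrable P0 X" "(\<integral>\<omega>. X \<omega> \<partial>P0) \<le> (s / r - 1) * (\<integral>\<omega>. neg_part X \<omega> \<partial>P0)"
      using integral_le_neg_part_of_supermartingale[OF *(1) assms(1) *(2), of r s X] rs bounds *(3,4)
      by auto
  qed
  have self: "equivalent_prob P0 P0"
    using assms(1) by (simp add: equivalent_prob_def)
  show ?thesis
  proof (intro conjI iffI; elim exE conjE)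
    fix P assume "ESM P0 L P"
    then show "\<exists>Q. equivalent_prob P0 Q \<and> (\<exists>k\<ge>0. \<forall>X\<in>L. integrable Q X \<and>
        (\<integral>\<omega>. X \<omega> \<partial>Q) \<le> k * (\<integral>\<omega>. neg_part X \<omega> \<partial>Q))"
      by (intro exI[of _ P] bound_from_ESM)
  next
    fix Q k assume "equivalent_prob P0 Q" "0 \<le> k" "\<forall>X\<in>L. integrable Q X \<and>
        (\<integral>\<omega>. X \<omega> \<partial>Q) \<le> k * (\<integral>\<omega>. neg_part X \<omega> \<partial>Q)"
    from ESM_from_bound[OF this] show "\<exists>P. ESM P0 L P" by blast
  qed (fact bound_from_comparable_ESM ESM_from_bound[OF self])+
qed

end
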